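(* The following identity holds in $\mathcal{A}_{\mathbb{Z}[t]}$: \begin{align*} &(1+t^{\boldsymbol{p}})\pounds_{\mathcal{A}, \{1\}^3}(t)+t^{\boldsymbol{p}}(1+t^{\boldsymbol{p}})\widetilde{\pounds}_{\mathcal{A},\{1\}^3}(t) +2t^{\boldsymbol{p}}\pounds^*_{\mathcal{A}, \{1\}^3}(1,t,1)+t^{\boldsymbol{p}}\pounds_{\mathcal{A}, (1,2)}(t)+t^{\boldsymbol{p}}\widetilde{\pounds}_{\mathcal{A}, (2,1)}(t)\\ =\;&(2-t^{\boldsymbol{p}})\pounds_{\mathcal{A}, \{1\}^3}(1-t)+(2-t^{\boldsymbol{p}})(1-t^{\boldsymbol{p}})\widetilde{\pounds}_{\mathcal{A},\{1\}^3}(1-t) +2(1-t^{\boldsymbol{p}})\pounds^*_{\mathcal{A}, \{1\}^3}(1,1-t,1)\\ &+(1-t^{\boldsymbol{p}})\pounds_{\mathcal{A}, (1,2)}(1-t)+(1-t^{\boldsymbol{p}})\widetilde{\pounds}_{\mathcal{A}, (2,1)}(1-t). \end{align*}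
   Context: Let $\mathcal{A}_{\mathbb{Z}[t]}:=\bigl(\prod_p (\mathbb{Z}/p\mathbb{Z})[t]\bigr)/\bigl(\bigoplus_p (\mathbb{Z}/p\mathbb{Z})[t]\bigr)$, where $p$ runs over all primes; thus two families of polynomials represent the same element if and only if they agree for all but finitely many primes $p$. For variables $\boldsymbol{t}=(t_1,\ldots,t_r)$, define $\mathcal{A}_{\mathbb{Z}[\boldsymbol{t}]}$ in the same way with $(\mathbb{Z}/p\mathbb{Z})[\boldsymbol{t}]$. Let $t^{\boldsymbol{p}}$ denote the class of $(t^p \bmod p)_p$. Substitutions of polynomials in $t$ for variables are made in each $p$-component. For an index $\mathbf{k}=(k_1,\ldots,k_r)$ of positive integers, define the finite multiple polylogarithms (of Sakugawa--Seki type) $$\pounds^{*}_{\mathcal{A}, \mathbf{k}}(t_1, \ldots, t_r):=\sum_{0<n_1<\cdots<n_r<p}\frac{t_1^{n_1}\cdots t_r^{n_r}}{n_1^{k_1}\cdots n_r^{k_r}}\bmod p \in \mathcal{A}_{\mathbb{Z}[\boldsymbol{t}]},$$ $$\pounds_{\mathcal{A}, \mathbf{k}}(t):=\pounds^*_{\mathcal{A}, \mathbf{k}}(\{1\}^{r-1}, t) \in \mathcal{A}_{\mathbb{Z}[t]},\qquad \widetilde{\pounds}_{\mathcal{A}, \mathbf{k}}(t):=\pounds^*_{\mathcal{A}, \mathbf{k}}(t, \{1\}^{r-1}) \in \mathcal{A}_{\mathbb{Z}[t]}.$$ Here $\{1\}^m$ denotes $1,\ldots,1$ ($m$ times). *)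

theory Defs
  imports
    "HOL-Computational_Algebra.Polynomial"
    "HOL-Computational_Algebra.Primes"
    "HOL-Number_Theory.Modular_Inverse"
    "HOL-Library.Poly_Mapping"
begin

section \<open>The ring \<open>\<A>\<^sub>R\<close>\<close>

text \<open>
  For a commutative ring \<open>R\<close>, the type \<open>R adelic\<close> is
  \<open>\<A>\<^sub>R = (\<Prod>\<^sub>p R/pR) / (\<Oplus>\<^sub>p R/pR)\<close>, \<open>p\<close> ranging over the primes.  Elements of \<open>\<Prod>\<^sub>p R/pR\<close> are
  given by families of representatives in \<open>R\<close>; the entries at non-prime indices are ignored.
  For \<open>R = \<int>[t]\<close> (the type \<^typ>\<open>int poly\<close>), \<open>R/pR\<close> is \<open>(\<int>/p\<int>)[t]\<close>, so
  \<open>int poly adelic\<close> is \<open>\<A>\<^bsub>\<int>[t]\<^esub>\<close>.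
\<close>

definition adelic_eq :: "(nat \<Rightarrow> 'a::comm_ring_1) \<Rightarrow> (nat \<Rightarrow> 'a) \<Rightarrow> bool" where
  "adelic_eq f g \<longleftrightarrow> finite {p. prime p \<and> \<not> of_nat p dvd (f p - g p)}"

lemma adelic_eq_combine:
  assumes "adelic_eq f f'" "adelic_eq g g'"
    and "\<And>p. \<lbrakk>of_nat p dvd (f p - f' p); of_nat p dvd (g p - g' p)\<rbrakk>
               \<Longrightarrow> of_nat p dvd (h p - h' p)"
  shows "adelic_eq h h'"
proof -
  have "{p. prime p \<and> \<not> of_nat p dvd (h p - h' p)} \<subseteq>
    {p. prime p \<and> \<not> of_nat p dvd (f p - f' p)} \<union> {p. prime p \<and> \<not> of_nat p dvd (g p - g' p)}"
    using assms(3) by blast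
  then show ?thesis
    using assms(1,2) unfolding adelic_eq_def by (meson finite_Un finite_subset)
qed

lemma adelic_eq_sym:
  assumes "adelic_eq f g"
  shows "adelic_eq g f"
  by (rule adelic_eq_combine[OF assms assms]) (metis dvd_minus_iff minus_diff_eq)

lemma equivp_adelic_eq: "equivp adelic_eq"
proof (rule equivpI)
  show "reflp (adelic_eq :: (nat \<Rightarrow> 'a) \<Rightarrow> _)"
    by (rule reflpI) (simp add: adelic_eq_def)
  show "symp (adelic_eq :: (nat \<Rightarrow> 'a) \<Rightarrow> _)"
    by (rule sympI) (rule adelic_eq_sym)
  show "transp (adelic_eq :: (nat \<Rightarrow> 'a) \<Rightarrow> _)"
  proof (rule transpI)
    fix f g h :: "nat \<Rightarrow> 'a"
    assume a: "adelic_eq f g" "adelic_eq g h"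
    show "adelic_eq f h"
    proof (rule adelic_eq_combine[OF a])
      fix p
      assume "of_nat p dvd (f p - g p)" "of_nat p dvd (g p - h p)"
      from dvd_add[OF this] show "of_nat p dvd (f p - h p)" by simp
    qed
  qed
qed

quotient_type (overloaded) 'a adelic = "nat \<Rightarrow> 'a::comm_ring_1" / adelic_eq
  morphisms rep_adelic abs_adelic
  by (rule equivp_adelic_eq)

text \<open>
  There is no instance of \<^class>\<open>comm_ring_1\<close>, which demands \<open>0 \<noteq> 1\<close>: \<open>\<A>\<^sub>R\<close> is the zero ring when
  almost all primes are invertible in \<open>R\<close>.
\<close>

instantiation adelic :: (comm_ring_1) "{comm_ring, comm_monoid_mult, numeral}"
begin

lift_definition zero_adelic :: "'a adelic" is "\<lambda>_. 0" .

lift_definition one_adelic :: "'a adelic" is "\<lambda>_. 1" .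

lift_definition plus_adelic :: "'a adelic \<Rightarrow> 'a adelic \<Rightarrow> 'a adelic" is "\<lambda>f g p. f p + g p"
proof -
  fix f f' g g' :: "nat \<Rightarrow> 'a"
  assume a: "adelic_eq f f'" "adelic_eq g g'"
  show "adelic_eq (\<lambda>p. f p + g p) (\<lambda>p. f' p + g' p)"
  proof (rule adelic_eq_combine[OF a])
    fix p
    assume "of_nat p dvd (f p - f' p)" "of_nat p dvd (g p - g' p)"
    from dvd_add[OF this] show "of_nat p dvd (f p + g p - (f' p + g' p))"
      by (simp add: algebra_simps)
  qed
qed

lift_definition minus_adelic :: "'a adelic \<Rightarrow> 'a adelic \<Rightarrow> 'a adelic" is "\<lambda>f g p. f p - g p"
proof -
  fix f f' g g' :: "nat \<Rightarrow> 'a"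
  assume a: "adelic_eq f f'" "adelic_eq g g'"
  show "adelic_eq (\<lambda>p. f p - g p) (\<lambda>p. f' p - g' p)"
  proof (rule adelic_eq_combine[OF a])
    fix p
    assume "of_nat p dvd (f p - f' p)" "of_nat p dvd (g p - g' p)"
    from dvd_diff[OF this] show "of_nat p dvd (f p - g p - (f' p - g' p))"
      by (simp add: algebra_simps)
  qed
qed

lift_definition uminus_adelic :: "'a adelic \<Rightarrow> 'a adelic" is "\<lambda>f p. - f p"
  by (drule adelic_eq_sym) (simp add: adelic_eq_def)

lift_definition times_adelic :: "'a adelic \<Rightarrow> 'a adelic \<Rightarrow> 'a adelic" is "\<lambda>f g p. f p * g p"
proof -
  fix f f' g g' :: "nat \<Rightarrow> 'a"
  assume a: "adelic_eq f f'" "adelic_eq g g'"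
  show "adelic_eq (\<lambda>p. f p * g p) (\<lambda>p. f' p * g' p)"
  proof (rule adelic_eq_combine[OF a])
    fix p
    assume "of_nat p dvd (f p - f' p)" "of_nat p dvd (g p - g' p)"
    then have "of_nat p dvd (f p - f' p) * g p + f' p * (g p - g' p)"
      by (intro dvd_add dvd_mult dvd_mult2)
    then show "of_nat p dvd (f p * g p - f' p * g' p)"
      by (simp add: algebra_simps)
  qed
qed

instance
  by standard (transfer, simp add: adelic_eq_def algebra_simps)+

end


section \<open>Substitution of polynomials for the variables\<close>

text \<open>
  Multivariate polynomials over \<open>\<int>\<close> are elements of the monoid ring of \<open>nat \<Rightarrow>\<^sub>0 nat\<close>.  The variables
  are indexed by \<open>nat\<close>, so that the mathematical \<open>t\<^sub>1, \<dots>, t\<^sub>r\<close> are \<open>var 0, \<dots>, var (r - 1)\<close>, and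
  \<open>\<int>[t\<^sub>1, \<dots>, t\<^sub>r]\<close> is the subring of the polynomials involving no other variable.
\<close>

type_synonym mpoly_int = "(nat \<Rightarrow>\<^sub>0 nat) \<Rightarrow>\<^sub>0 int"

definition var :: "nat \<Rightarrow> mpoly_int" where
  "var i = Poly_Mapping.single (Poly_Mapping.single i 1) 1"

definition subst_monomial :: "(nat \<Rightarrow> 'a::comm_ring_1) \<Rightarrow> (nat \<Rightarrow>\<^sub>0 nat) \<Rightarrow> 'a" where
  "subst_monomial \<sigma> m = (\<Prod>i\<in>Poly_Mapping.keys m. \<sigma> i ^ Poly_Mapping.lookup m i)"

definition subst_mpoly :: "(nat \<Rightarrow> 'a::comm_ring_1) \<Rightarrow> mpoly_int \<Rightarrow> 'a" where
  "subst_mpoly \<sigma> f = (\<Sum>m\<in>Poly_Mapping.keys f. of_int (Poly_Mapping.lookup f m) * subst_monomial \<sigma> m)"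

lemma subst_mpoly_superset:
  assumes "finite A" "Poly_Mapping.keys f \<subseteq> A"
  shows "subst_mpoly \<sigma> f = (\<Sum>m\<in>A. of_int (Poly_Mapping.lookup f m) * subst_monomial \<sigma> m)"
  unfolding subst_mpoly_def
  by (rule sum.mono_neutral_left) (use assms in \<open>auto simp: in_keys_iff\<close>)

lemma subst_mpoly_0 [simp]: "subst_mpoly \<sigma> 0 = 0"
  by (simp add: subst_mpoly_def)

lemma subst_mpoly_add: "subst_mpoly \<sigma> (f + g) = subst_mpoly \<sigma> f + subst_mpoly \<sigma> g"
proof -
  let ?A = "Poly_Mapping.keys f \<union> Poly_Mapping.keys g"
  have "Poly_Mapping.keys (f + g) \<subseteq> ?A" by (rule keys_add)
  then show ?thesis
    by (simp add: subst_mpoly_superset[of ?A] lookup_add ring_distribs sum.distrib)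
qed

lemma subst_mpoly_sum: "subst_mpoly \<sigma> (sum f A) = (\<Sum>x\<in>A. subst_mpoly \<sigma> (f x))"
  by (induction A rule: infinite_finite_induct) (simp_all add: subst_mpoly_add)

lemma subst_mpoly_single:
  "subst_mpoly \<sigma> (Poly_Mapping.single m c) = of_int c * subst_monomial \<sigma> m"
  by (cases "c = 0") (simp_all add: subst_mpoly_def)

lemma subst_mpoly_uminus: "subst_mpoly \<sigma> (- f) = - subst_mpoly \<sigma> f"
  using subst_mpoly_add[of \<sigma> f "- f"] by (simp add: eq_neg_iff_add_eq_0 add.commute)

lemma subst_mpoly_diff: "subst_mpoly \<sigma> (f - g) = subst_mpoly \<sigma> f - subst_mpoly \<sigma> g"
  using subst_mpoly_add[of \<sigma> f "- g"] by (simp add: subst_mpoly_uminus)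

lemma subst_monomial_superset:
  assumes "finite A" "Poly_Mapping.keys m \<subseteq> A"
  shows "subst_monomial \<sigma> m = (\<Prod>i\<in>A. \<sigma> i ^ Poly_Mapping.lookup m i)"
  unfolding subst_monomial_def
  by (rule prod.mono_neutral_left) (use assms in \<open>auto simp: in_keys_iff\<close>)

lemma subst_monomial_add:
  "subst_monomial \<sigma> (m + n) = subst_monomial \<sigma> m * subst_monomial \<sigma> n"
proof -
  let ?A = "Poly_Mapping.keys m \<union> Poly_Mapping.keys n"
  have "Poly_Mapping.keys (m + n) \<subseteq> ?A" by (rule keys_add)
  then show ?thesis
    by (simp add: subst_monomial_superset[of ?A] lookup_add power_add prod.distrib)
qed

lemma subst_mpoly_1 [simp]: "subst_mpoly \<sigma> 1 = 1"
  by (simp add: subst_mpoly_def subst_monomial_def)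

lemma mpoly_eq_sum_single:
  "f = (\<Sum>m\<in>Poly_Mapping.keys f. Poly_Mapping.single m (Poly_Mapping.lookup f m))" for f :: mpoly_int
  by (rule poly_mapping_eqI)
    (auto simp: lookup_sum lookup_single when_def in_keys_iff sum.delta)

lemma subst_mpoly_mult: "subst_mpoly \<sigma> (f * g) = subst_mpoly \<sigma> f * subst_mpoly \<sigma> g"
proof -
  have "subst_mpoly \<sigma> (f * g) = subst_mpoly \<sigma>
     ((\<Sum>m\<in>Poly_Mapping.keys f. Poly_Mapping.single m (Poly_Mapping.lookup f m)) *
      (\<Sum>n\<in>Poly_Mapping.keys g. Poly_Mapping.single n (Poly_Mapping.lookup g n)))"
    by (simp flip: mpoly_eq_sum_single)
  also have "\<dots> = subst_mpoly \<sigma> f * subst_mpoly \<sigma> g"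
    by (simp add: sum_product mult_single subst_mpoly_sum subst_mpoly_single
        subst_monomial_add subst_mpoly_def[of \<sigma> f] subst_mpoly_def[of \<sigma> g] mult_ac)
  finally show ?thesis .
qed

lemma subst_mpoly_power: "subst_mpoly \<sigma> (f ^ n) = subst_mpoly \<sigma> f ^ n"
  by (induction n) (simp_all add: subst_mpoly_mult)

lemma subst_mpoly_prod: "subst_mpoly \<sigma> (prod f A) = (\<Prod>x\<in>A. subst_mpoly \<sigma> (f x))"
  by (induction A rule: infinite_finite_induct) (simp_all add: subst_mpoly_mult)

lemma subst_mpoly_of_nat [simp]: "subst_mpoly \<sigma> (of_nat n) = of_nat n"
  by (induction n) (simp_all add: subst_mpoly_add)

lemma subst_mpoly_of_int [simp]: "subst_mpoly \<sigma> (of_int n) = of_int n"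
  by (cases n rule: int_cases2) (simp_all add: subst_mpoly_uminus)

lemma subst_mpoly_var [simp]: "subst_mpoly \<sigma> (var i) = \<sigma> i"
  by (simp add: var_def subst_mpoly_single subst_monomial_def)

lift_definition subst_adelic ::
  "(nat \<Rightarrow> 'a::comm_ring_1) \<Rightarrow> mpoly_int adelic \<Rightarrow> 'a adelic"
  is "\<lambda>\<sigma> f p. subst_mpoly \<sigma> (f p)"
proof -
  fix \<sigma> :: "nat \<Rightarrow> 'a" and f g :: "nat \<Rightarrow> mpoly_int"
  assume a: "adelic_eq f g"
  show "adelic_eq (\<lambda>p. subst_mpoly \<sigma> (f p)) (\<lambda>p. subst_mpoly \<sigma> (g p))"
  proof (rule adelic_eq_combine[OF a a])
    fix p
    assume "of_nat p dvd (f p - g p)"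
    then obtain h where "f p - g p = of_nat p * h" by (elim dvdE)
    then have "subst_mpoly \<sigma> (f p) - subst_mpoly \<sigma> (g p) = of_nat p * subst_mpoly \<sigma> h"
      by (metis subst_mpoly_diff subst_mpoly_mult subst_mpoly_of_nat)
    then show "of_nat p dvd (subst_mpoly \<sigma> (f p) - subst_mpoly \<sigma> (g p))" by simp
  qed
qed


section \<open>Finite multiple polylogarithms\<close>

definition index_tuples :: "nat \<Rightarrow> nat \<Rightarrow> nat list set" where
  "index_tuples r p = {ns. length ns = r \<and> sorted_wrt (<) ns \<and> set ns \<subseteq> {0<..<p}}"

text \<open>
  The \<open>p\<close>-component of the defining sum, with the entries \<open>x 0, \<dots>, x (r - 1)\<close> of a ring in place of
  the variables.  The coefficient \<open>1 / (n\<^sub>1\<^bsup>k\<^sub>1\<^esup> \<cdots> n\<^sub>r\<^bsup>k\<^sub>r\<^esup>)\<close> in \<open>\<int>/p\<int>\<close> is represented by an integer;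
  for \<open>0 < n < p\<close> with \<open>p\<close> prime, \<^term>\<open>modular_inverse (int p) (int n)\<close> is an inverse of \<open>n\<close> modulo \<open>p\<close>.
\<close>

definition polylog_component ::
  "nat list \<Rightarrow> (nat \<Rightarrow> 'a::comm_ring_1) \<Rightarrow> nat \<Rightarrow> 'a" where
  "polylog_component ks x p =
    (\<Sum>ns\<in>index_tuples (length ks) p. \<Prod>i<length ks.
       of_int (modular_inverse (int p) (int (ns ! i)) ^ (ks ! i)) * x i ^ (ns ! i))"

definition fin_mpolylog :: "nat list \<Rightarrow> mpoly_int adelic" where
  "fin_mpolylog ks = abs_adelic (polylog_component ks var)"

text \<open>
  In the following, the index \<open>ks\<close> consists of positive integers, and \<open>xs\<close> has the same length as
  \<open>ks\<close>.  The entries of \<open>xs\<close> are substituted for the variables in each \<open>p\<close>-component.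
\<close>

definition polylog_star :: "nat list \<Rightarrow> 'a::comm_ring_1 list \<Rightarrow> 'a adelic" where
  "polylog_star ks xs = subst_adelic ((!) xs) (fin_mpolylog ks)"

definition polylog :: "nat list \<Rightarrow> 'a::comm_ring_1 \<Rightarrow> 'a adelic" where
  "polylog ks x = polylog_star ks (replicate (length ks - 1) 1 @ [x])"

definition polylog_tilde :: "nat list \<Rightarrow> 'a::comm_ring_1 \<Rightarrow> 'a adelic" where
  "polylog_tilde ks x = polylog_star ks (x # replicate (length ks - 1) 1)"

lemma polylog_star_eq: "polylog_star ks xs = abs_adelic (polylog_component ks ((!) xs))"
  unfolding polylog_star_def fin_mpolylog_def subst_adelic.abs_eq polylog_component_def
  by (simp only: subst_mpoly_sum subst_mpoly_prod subst_mpoly_mult subst_mpoly_power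
      subst_mpoly_of_int subst_mpoly_var)

definition t_var :: "int poly" where
  "t_var = [:0, 1:]"

text \<open>The class \<open>t\<^sup>p\<close> (with bold \<open>p\<close>) of the family \<open>(t\<^sup>p mod p)\<^sub>p\<close>.\<close>

definition t_bold_p :: "int poly adelic" where
  "t_bold_p = abs_adelic (\<lambda>p. t_var ^ p)"

end

theory Submission
  imports Defs
begin

text \<open>
  The right-hand side is the image of the left-hand side \<open>F\<^sub>3\<close> under \<open>t \<mapsto> 1 - t\<close>, because
  \<open>(1 - t)\<^sup>p = 1 - t\<^sup>p\<close> modulo \<open>p\<close>.  So the claim is that \<open>F\<^sub>3\<close> is invariant under this
  reflection.  Write \<open>T\<close> for \<open>t\<^sup>p\<close> and \<open>D = t (1 - t) d/dt\<close>; since \<open>D T = 0\<close> modulo \<open>p\<close>, the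
  derivation \<open>D\<close> treats \<open>T\<close> as a constant.  The polynomial \<open>F\<^sub>3\<close> is the last in a chain of
  iterated integrals: with
  \<open>F\<^sub>1 = \<Sum> t\<^sup>n / n\<close> and \<open>F\<^sub>2 = \<Sum> t\<^sup>n / (m n) + T \<Sum> t\<^sup>m / (m n)\<close>, where \<open>0 < m < n < p\<close>, one has
  \<open>D F\<^sub>1 = t - T\<close>, \<open>D F\<^sub>2 = (t - T) F\<^sub>1\<close> and \<open>D F\<^sub>3 = (t - T) F\<^sub>2\<close>.

  The factor \<open>t - T\<close> and the derivation \<open>D\<close> both change sign under the reflection, so the
  invariance of \<open>F\<^sub>k\<close> implies that \<open>F\<^sub>k\<^sub>+\<^sub>1\<close> and its reflection have the same derivative.
  Their difference is then a polynomial in \<open>T\<close>, of degree at most 2 in \<open>T\<close> and antisymmetric.  It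
  vanishes at \<open>0\<close>, because \<open>F\<^sub>k\<^sub>+\<^sub>1\<close> vanishes at \<open>0\<close> and \<open>1\<close>.  Such a polynomial is a multiple of
  \<open>T (1 - T)\<close>, which is symmetric, so it is zero.  This step is \<open>reflect_eqI\<close>; it is applied
  once for each of the three \<open>F\<^sub>k\<close>.

  What remains is to compute the derivatives, by summation by parts (\<open>gen_sum_below\<close>,
  \<open>gen_sum_above\<close>, \<open>gen_sum_below_above\<close>), and the values at \<open>1\<close>.  Both rest on the vanishing
  modulo \<open>p > 3\<close> of sums such as \<open>\<Sum> 1/n\<close> and \<open>\<Sum> 1/(m n)\<close>.
\<close>

section \<open>Differentiation and reflection on the adelic ring\<close>

text \<open>
  The bound 3 serves every congruence below: the antisymmetry arguments divide by 2, and the sum of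
  the inverse squares needs 6 to be invertible.
\<close>

lemma abs_adelic_eqI:
  assumes "\<And>p. prime p \<Longrightarrow> p > 3 \<Longrightarrow> of_nat p dvd f p - g p"
  shows "abs_adelic f = abs_adelic g"
proof -
  have "{p. prime p \<and> \<not> of_nat p dvd (f p - g p)} \<subseteq> {..3}"
    using assms by (auto simp: not_less[symmetric])
  then show ?thesis
    by (simp add: adelic.abs_eq_iff adelic_eq_def finite_subset)
qed

text \<open>
  The derivation \<open>t (1 - t) d/dt\<close>.  The factor \<open>t (1 - t)\<close> clears the denominators of both differential
  forms \<open>dt/t\<close> and \<open>dt/(1 - t)\<close> of the theory of polylogarithms, and it is invariant under
  \<open>t \<mapsto> 1 - t\<close>.
\<close>

lift_definition deriv_adelic :: "int poly adelic \<Rightarrow> int poly adelic"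
  is "\<lambda>f p. t_var * (1 - t_var) * pderiv (f p)"
proof -
  fix f g :: "nat \<Rightarrow> int poly"
  assume a: "adelic_eq f g"
  show "adelic_eq (\<lambda>p. t_var * (1 - t_var) * pderiv (f p)) (\<lambda>p. t_var * (1 - t_var) * pderiv (g p))"
  proof (rule adelic_eq_combine[OF a a])
    fix p
    assume "of_nat p dvd (f p - g p)"
    then obtain h where h: "f p - g p = of_nat p * h" by (elim dvdE)
    have "pderiv (f p) - pderiv (g p) = of_nat p * pderiv h"
      by (simp flip: pderiv_diff add: h pderiv_mult)
    then show "of_nat p dvd t_var * (1 - t_var) * pderiv (f p) - t_var * (1 - t_var) * pderiv (g p)"
      by (simp flip: right_diff_distrib)
  qed
qed

lemma pcompose_power: "pcompose (f ^ n) g = pcompose f g ^ n" for f g :: "'a::comm_ring_1 poly"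
  by (induction n) (simp_all add: pcompose_1 pcompose_mult)

lemma pcompose_t_var [simp]: "pcompose t_var g = g"
  by (simp add: t_var_def pcompose_pCons)

lemma of_nat_dvd_pcompose:
  fixes f g :: "'a::comm_ring_1 poly"
  assumes "of_nat p dvd f"
  shows "of_nat p dvd pcompose f g"
proof -
  obtain q where "f = of_nat p * q" using assms by (elim dvdE)
  moreover have "pcompose (of_nat p) g = of_nat p" by (simp add: of_nat_poly)
  ultimately show ?thesis by (simp add: pcompose_mult)
qed

lift_definition reflect :: "int poly adelic \<Rightarrow> int poly adelic"
  is "\<lambda>f p. pcompose (f p) (1 - t_var)"
proof -
  fix f g :: "nat \<Rightarrow> int poly"
  assume a: "adelic_eq f g"
  show "adelic_eq (\<lambda>p. pcompose (f p) (1 - t_var)) (\<lambda>p. pcompose (g p) (1 - t_var))"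
  proof (rule adelic_eq_combine[OF a a])
    fix p
    assume "of_nat p dvd (f p - g p)"
    then show "of_nat p dvd pcompose (f p) (1 - t_var) - pcompose (g p) (1 - t_var)"
      unfolding pcompose_diff[symmetric] by (rule of_nat_dvd_pcompose)
  qed
qed

definition t_adelic :: "int poly adelic" where
  "t_adelic = abs_adelic (\<lambda>_. t_var)"

lemma deriv_adelic_add: "deriv_adelic (x + y) = deriv_adelic x + deriv_adelic y"
  by transfer (simp add: equivp_reflp[OF equivp_adelic_eq] pderiv_add algebra_simps)

lemma deriv_adelic_mult: "deriv_adelic (x * y) = deriv_adelic x * y + x * deriv_adelic y"
  by transfer (simp add: equivp_reflp[OF equivp_adelic_eq] pderiv_mult algebra_simps)

lemma deriv_adelic_1 [simp]: "deriv_adelic 1 = 0"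
  by transfer (simp add: equivp_reflp[OF equivp_adelic_eq])

lemma deriv_adelic_t_bold_p [simp]: "deriv_adelic t_bold_p = 0"
  unfolding t_bold_p_def deriv_adelic.abs_eq zero_adelic_def
proof (rule abs_adelic_eqI)
  fix p :: nat
  have "pderiv (t_var ^ p) = of_nat p * (t_var ^ (p - 1) * pderiv t_var)"
    by (simp add: pderiv_power of_nat_poly)
  then show "of_nat p dvd t_var * (1 - t_var) * pderiv (t_var ^ p) - 0" by simp
qed

lemma reflect_add: "reflect (x + y) = reflect x + reflect y"
  by transfer (simp add: equivp_reflp[OF equivp_adelic_eq] pcompose_add)

lemma reflect_diff: "reflect (x - y) = reflect x - reflect y"
  by transfer (simp add: equivp_reflp[OF equivp_adelic_eq] pcompose_diff)

lemma reflect_mult: "reflect (x * y) = reflect x * reflect y"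
  by transfer (simp add: equivp_reflp[OF equivp_adelic_eq] pcompose_mult)

lemma reflect_1 [simp]: "reflect 1 = 1"
  by transfer (simp add: equivp_reflp[OF equivp_adelic_eq] pcompose_1)

lemma reflect_t_adelic: "reflect t_adelic = 1 - t_adelic"
  by (simp add: t_adelic_def reflect.abs_eq one_adelic_def minus_adelic.abs_eq t_var_def pcompose_pCons)

lemma deriv_adelic_reflect: "deriv_adelic (reflect x) = - reflect (deriv_adelic x)"
proof transfer
  fix f :: "nat \<Rightarrow> int poly"
  have "t_var * (1 - t_var) * pderiv (pcompose h (1 - t_var))
      = - pcompose (t_var * (1 - t_var) * pderiv h) (1 - t_var)" for h
    by (simp add: pderiv_pcompose pcompose_mult pcompose_diff pcompose_1 t_var_def pcompose_pCons
        pderiv_diff pderiv_pCons)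
  then show "adelic_eq (\<lambda>p. t_var * (1 - t_var) * pderiv (pcompose (f p) (1 - t_var)))
      (\<lambda>p. - pcompose (t_var * (1 - t_var) * pderiv (f p)) (1 - t_var))"
    by (simp add: equivp_reflp[OF equivp_adelic_eq])
qed

lemma one_minus_power_prime_dvd:
  fixes x :: "'a::comm_ring_1"
  assumes "prime p" "odd p"
  shows "of_nat p dvd (1 - x) ^ p - (1 - x ^ p)"
proof -
  have p: "p > 0" using assms(1) by (simp add: prime_gt_0_nat)
  have "(1 - x) ^ p = (\<Sum>k\<le>p. of_nat (p choose k) * (- x) ^ k)"
    using binomial_ring[of "- x" 1 p] by (simp add: add.commute)
  also have "{..p} = insert 0 (insert p {0<..<p})" using p by auto
  also have "(\<Sum>k\<in>\<dots>. of_nat (p choose k) * (- x) ^ k)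
      = 1 - x ^ p + (\<Sum>k\<in>{0<..<p}. of_nat (p choose k) * (- x) ^ k)"
    using p assms(2) by simp
  finally have "(1 - x) ^ p - (1 - x ^ p) = (\<Sum>k\<in>{0<..<p}. of_nat (p choose k) * (- x) ^ k)"
    by simp
  also have "of_nat p dvd \<dots>"
  proof (rule dvd_sum)
    fix k assume "k \<in> {0<..<p}"
    then have "p dvd p choose k" using assms(1) by (intro dvd_choose_prime) auto
    then show "of_nat p dvd of_nat (p choose k) * (- x) ^ k"
      by (intro dvd_mult2) (auto elim!: dvdE)
  qed
  finally show ?thesis .
qed

lemma reflect_t_bold_p: "reflect t_bold_p = 1 - t_bold_p"
  unfolding t_bold_p_def reflect.abs_eq one_adelic_def minus_adelic.abs_eq
proof (rule abs_adelic_eqI)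
  fix p :: nat assume p: "prime p" "p > 3"
  show "of_nat p dvd pcompose (t_var ^ p) (1 - t_var) - (1 - t_var ^ p)"
    using one_minus_power_prime_dvd[of p t_var] p prime_odd_nat[of p] by (simp add: pcompose_power)
qed

lemma dvd_of_int_mult: "int p dvd c \<Longrightarrow> of_nat p dvd (of_int c * x :: 'a::comm_ring_1)"
  by (auto elim!: dvdE simp: mult.assoc)

lemma of_nat_dvd_int_poly_iff: "of_nat p dvd (h :: int poly) \<longleftrightarrow> (\<forall>n. int p dvd coeff h n)"
  by (simp add: of_nat_poly const_poly_dvd_iff)

text \<open>
  Modulo \<open>p\<close>, the constants of the derivation are exactly the polynomials in \<open>t\<^sup>p\<close>.  The factors
  \<open>t\<close> and \<open>1 - t\<close> can be cancelled because \<open>p\<close> is a prime element of \<open>\<int>[t]\<close>.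
\<close>

lemma dvd_coeff_of_dvd_pderiv:
  fixes h :: "int poly"
  assumes p: "prime p" and d: "of_nat p dvd t_var * (1 - t_var) * pderiv h" and m: "\<not> p dvd m"
  shows "int p dvd coeff h m"
proof -
  have pe: "prime_elem (of_nat p :: int poly)"
    unfolding of_nat_poly by (rule lift_prime_elem_poly) (use p in simp)
  have 1: "\<not> of_nat p dvd t_var"
    unfolding of_nat_dvd_int_poly_iff t_var_def not_all
    by (rule exI[of _ 1]) (use p prime_gt_1_nat in \<open>force simp: zdvd_not_zless\<close>)
  have 2: "\<not> of_nat p dvd 1 - t_var"
    unfolding of_nat_dvd_int_poly_iff t_var_def not_all
    by (rule exI[of _ 0]) (use p prime_gt_1_nat in \<open>force simp: zdvd_not_zless\<close>)
  have "of_nat p dvd pderiv h"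
    using d 1 2 pe by (auto simp: prime_elem_dvd_mult_iff)
  moreover obtain k where k: "m = Suc k" using m by (cases m) auto
  ultimately have "int p dvd int m * coeff h m"
    by (auto simp: of_nat_dvd_int_poly_iff coeff_pderiv)
  then show ?thesis
    using p m by (subst (asm) prime_dvd_mult_iff) (auto simp: int_dvd_int_iff)
qed

text \<open>
  Modulo \<open>p\<close> the polynomial is \<open>b t\<^sup>p + c t\<^sup>2\<^sup>p\<close>.  By antisymmetry it vanishes at \<open>1\<close> as well as at
  \<open>0\<close>, so \<open>c = - b\<close>.  But then \<open>b t\<^sup>p (1 - t\<^sup>p)\<close> is symmetric, hence equal to its own negative.
\<close>

lemma dvd_if_antisymmetric:
  fixes h :: "int poly"
  assumes p: "prime p" "odd p" and deg: "degree h < 3 * p"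
    and d: "of_nat p dvd t_var * (1 - t_var) * pderiv h"
    and anti: "pcompose h (1 - t_var) = - h" and h0: "int p dvd poly h 0"
  shows "of_nat p dvd h"
proof -
  define b c where "b = coeff h p" and "c = coeff h (2 * p)"
  have p1: "p > 1" using p(1) by (rule prime_gt_1_nat)
  \<comment> \<open>Only exponents \<open>0\<close>, \<open>p\<close> and \<open>2 p\<close> can survive, and the value at \<open>0\<close> removes the first.\<close>
  have h_eq: "of_nat p dvd h - (of_int b * t_var ^ p + of_int c * t_var ^ (2 * p))" (is "_ dvd h - ?g")
    unfolding of_nat_dvd_int_poly_iff
  proof
    fix n
    have tp: "t_var ^ k = monom 1 k" for k by (simp add: t_var_def monom_altdef)
    have g: "coeff ?g n = (if n = p then b else 0) + (if n = 2 * p then c else 0)"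
      by (simp add: tp of_int_poly)
    show "int p dvd coeff (h - ?g) n"
    proof (cases "p dvd n")
      case False
      then show ?thesis using dvd_coeff_of_dvd_pderiv[OF p(1) d, of n] g by auto
    next
      case True
      then obtain k where k: "n = p * k" ..
      consider "k = 0" | "k = 1" | "k = 2" | "k \<ge> 3" by linarith
      then show ?thesis
      proof cases
        case 1
        then show ?thesis using h0 k g p1 by (auto simp: poly_0_coeff_0)
      next
        case 4
        then have "n \<ge> 3 * p" using k by simp
        then have "n > degree h" "n \<noteq> p" "n \<noteq> 2 * p" using deg p1 by auto
        then show ?thesis using g by (simp add: coeff_eq_0)
      qed (use k g p1 in \<open>auto simp: b_def c_def mult.commute[of p 2]\<close>)
    qed
  qed
  have "poly h 1 = - poly h 0"
    using arg_cong[OF anti, of "\<lambda>f. poly f 0"] by (simp add: poly_pcompose t_var_def)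
  moreover have "int p dvd poly h 1 - (b + c)"
  proof -
    obtain q where "h - ?g = of_nat p * q" using h_eq by (elim dvdE)
    from arg_cong[OF this, of "\<lambda>f. poly f 1"] show ?thesis by (simp add: t_var_def of_int_poly)
  qed
  ultimately have bc: "int p dvd b + c"
    using h0 by (metis dvd_diff_right_iff dvd_minus_iff)
  have "of_nat p dvd ?g - of_int b * (t_var ^ p * (1 - t_var ^ p))"
  proof -
    have "?g - of_int b * (t_var ^ p * (1 - t_var ^ p)) = of_int (b + c) * t_var ^ (2 * p)"
      by (simp add: algebra_simps power_mult[of _ p 2] mult.commute[of 2 p] power2_eq_square)
    then show ?thesis using dvd_of_int_mult[OF bc, of "t_var ^ (2 * p)"] by (simp only:)
  qed
  from dvd_add[OF h_eq this]
  have h': "of_nat p dvd h - of_int b * (t_var ^ p * (1 - t_var ^ p))" (is "_ dvd h - ?s")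
    by (simp only: diff_add_cancel add_diff_eq)
  have "of_nat p dvd pcompose h (1 - t_var) - pcompose ?s (1 - t_var)"
    unfolding pcompose_diff[symmetric] by (rule of_nat_dvd_pcompose[OF h'])
  moreover have "of_nat p dvd pcompose ?s (1 - t_var) - ?s"
  proof -
    obtain e where e: "(1 - t_var) ^ p - (1 - t_var ^ p) = of_nat p * e"
      using one_minus_power_prime_dvd[OF p, of t_var] by (elim dvdE)
    have e': "(1 - t_var) ^ p = (1 - t_var ^ p) + of_nat p * e" by (simp flip: e)
    have pb: "pcompose (of_int b) (1 - t_var) = of_int b" by (simp add: of_int_poly)
    have "pcompose ?s (1 - t_var) - ?s = of_nat p * (of_int b * (e * (2 * t_var ^ p - 1 - of_nat p * e)))"
      by (simp only: pcompose_mult pcompose_diff pcompose_1 pcompose_power pcompose_t_var pb e') (simp add: algebra_simps)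
    then show ?thesis by simp
  qed
  ultimately have "of_nat p dvd pcompose h (1 - t_var) - pcompose ?s (1 - t_var) + (pcompose ?s (1 - t_var) - ?s)"
    by (rule dvd_add)
  then have "of_nat p dvd - h - ?s" by (simp only: anti diff_add_cancel add_diff_eq)
  with h' have "of_nat p dvd (h - ?s) - (- h - ?s)" by (rule dvd_diff)
  moreover have "(h - ?s) - (- h - ?s) = h + h" by (simp only: algebra_simps)
  ultimately have "of_nat p dvd h + h" by (simp only:)
  then have "int p dvd 2 * coeff h n" for n
    unfolding of_nat_dvd_int_poly_iff coeff_add mult_2 by blast
  moreover have "coprime (int p) 2" using p(2) by simp
  ultimately show ?thesis
    unfolding of_nat_dvd_int_poly_iff by (metis coprime_dvd_mult_right_iff)
qed

text \<open>
  The induction step along the chain of iterated integrals: invariance under reflection passes from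
  \<open>N\<close> to an integral \<open>G\<close> of \<open>N\<close> against \<open>(t - t\<^sup>p) / (t (1 - t)) dt\<close>.  The values of \<open>G\<close> at \<open>0\<close> and \<open>1\<close>
  and the degree bound fix the constants of integration.
\<close>

lemma reflect_eqI:
  assumes G: "G = abs_adelic g" and dG: "deriv_adelic G = (t_adelic - t_bold_p) * N"
    and N: "reflect N = N"
    and deg: "\<And>p. prime p \<Longrightarrow> p > 3 \<Longrightarrow> degree (g p) < 3 * p"
    and g0: "\<And>p. prime p \<Longrightarrow> p > 3 \<Longrightarrow> int p dvd poly (g p) 0"
    and g1: "\<And>p. prime p \<Longrightarrow> p > 3 \<Longrightarrow> int p dvd poly (g p) 1"
  shows "reflect G = G"
proof -
  define h where "h p = g p - pcompose (g p) (1 - t_var)" for p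
  have H: "abs_adelic h = G - reflect G"
    by (simp add: G reflect.abs_eq minus_adelic.abs_eq h_def[abs_def])
  have "deriv_adelic (reflect G) = deriv_adelic G"
    unfolding deriv_adelic_reflect dG
    by (simp add: reflect_mult reflect_diff N reflect_t_adelic reflect_t_bold_p algebra_simps)
  moreover have "deriv_adelic (G - reflect G) + deriv_adelic (reflect G) = deriv_adelic G"
    by (simp flip: deriv_adelic_add)
  ultimately have "deriv_adelic (abs_adelic h) = 0" by (simp add: H)
  then have fin: "finite {p. prime p \<and> \<not> of_nat p dvd t_var * (1 - t_var) * pderiv (h p)}"
    by (simp add: deriv_adelic.abs_eq zero_adelic_def adelic.abs_eq_iff adelic_eq_def)
  have "of_nat p dvd h p"
    if p: "prime p" "p > 3" and d: "of_nat p dvd t_var * (1 - t_var) * pderiv (h p)" for p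
  proof (rule dvd_if_antisymmetric[OF p(1) _ _ d])
    show "odd p" using p prime_odd_nat by auto
    have "degree (1 - t_var) = 1" by (simp add: t_var_def one_pCons)
    then show "degree (h p) < 3 * p"
      using deg[OF p] unfolding h_def
      by (intro degree_diff_less) (auto intro: order_le_less_trans[OF degree_pcompose_le])
    have "pcompose (pcompose f (1 - t_var)) (1 - t_var) = f" for f
      unfolding pcompose_assoc[symmetric] by (simp add: t_var_def pcompose_diff pcompose_1 pcompose_pCons)
    then show "pcompose (h p) (1 - t_var) = - h p" by (simp add: h_def pcompose_diff)
    show "int p dvd poly (h p) 0"
      using g0[OF p] g1[OF p] by (simp add: h_def poly_pcompose t_var_def)
  qed
  then have "{p. prime p \<and> \<not> of_nat p dvd h p} \<subseteq>
      {p. prime p \<and> \<not> of_nat p dvd t_var * (1 - t_var) * pderiv (h p)} \<union> {..3}"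
    by (auto simp: not_less[symmetric])
  then have "finite {p. prime p \<and> \<not> of_nat p dvd h p}"
    using fin by (meson finite_Un finite_atMost finite_subset)
  then have "abs_adelic h = 0"
    by (simp add: zero_adelic_def adelic.abs_eq_iff adelic_eq_def)
  then show ?thesis using H by (simp add: eq_diff_eq)
qed


section \<open>Generating polynomials of truncated nested sums\<close>

text \<open>
  The coefficients of the polylogarithms, such as \<open>1/n\<close>, make sense only modulo a prime.  A sequence
  of coefficients is therefore given as an integer function \<open>a p n\<close> of the prime and of the
  exponent, and nested sums are built by iterating operators on such functions.
\<close>

definition inv_mod :: "nat \<Rightarrow> nat \<Rightarrow> int" where
  "inv_mod p n = modular_inverse (int p) (int n)"

definition over :: "(nat \<Rightarrow> nat \<Rightarrow> int) \<Rightarrow> nat \<Rightarrow> nat \<Rightarrow> int" where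
  "over a p n = inv_mod p n * a p n"

definition sum_below :: "(nat \<Rightarrow> nat \<Rightarrow> int) \<Rightarrow> nat \<Rightarrow> nat \<Rightarrow> int" where
  "sum_below a p n = (\<Sum>m\<in>{0<..<n}. a p m)"

definition sum_above :: "(nat \<Rightarrow> nat \<Rightarrow> int) \<Rightarrow> nat \<Rightarrow> nat \<Rightarrow> int" where
  "sum_above a p n = (\<Sum>m\<in>{n<..<p}. a p m)"

definition gen_poly :: "(nat \<Rightarrow> nat \<Rightarrow> int) \<Rightarrow> nat \<Rightarrow> int poly" where
  "gen_poly a p = (\<Sum>n\<in>{0<..<p}. of_int (a p n) * t_var ^ n)"

definition gen :: "(nat \<Rightarrow> nat \<Rightarrow> int) \<Rightarrow> int poly adelic" where
  "gen a = abs_adelic (gen_poly a)"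

lemma greaterThanLessThan_Suc_nat: "0 < n \<Longrightarrow> {0<..<Suc n} = insert n {0<..<n}"
  by auto

lemma greaterThanLessThan_0_1 [simp]: "{0<..<Suc 0} = {}"
  by auto

text \<open>
  On coefficients, multiplication by \<open>1 - t\<close> takes differences.  For a nested sum the difference splits
  into a part \<open>b\<close> from the inner sums over indices below \<open>n\<close>, where a summand enters one step after
  its own index and so picks up a factor \<open>t\<close>, and a part \<open>c\<close> from the inner sums over indices above
  \<open>n\<close>, where a summand leaves at its own index.  The last two terms are boundary contributions.
\<close>

lemma summation_by_parts:
  fixes t :: "'a::comm_ring_1" and u b c :: "nat \<Rightarrow> int"
  assumes "p > 1" and "\<And>n. 0 < n \<Longrightarrow> Suc n < p \<Longrightarrow> u (Suc n) - u n = b n - c (Suc n)"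
  shows "(1 - t) * (\<Sum>n\<in>{0<..<p}. of_int (u n) * t ^ n) =
    t * (\<Sum>n\<in>{0<..<p}. of_int (b n) * t ^ n) - (\<Sum>n\<in>{0<..<p}. of_int (c n) * t ^ n)
    + of_int (u 1 + c 1) * t - of_int (u (p - 1) + b (p - 1)) * t ^ p"
proof -
  have "Suc 1 \<le> p" using assms(1) by simp
  then show ?thesis using assms(2)
  proof (induction p rule: dec_induct)
    case base
    have "{0<..<Suc 1} = {1}" by auto
    then show ?case by (simp add: algebra_simps)
  next
    case (step p)
    have u: "u p = u (p - 1) + b (p - 1) - c p"
      using step.prems[of "p - 1"] step.hyps by simp
    then have u': "of_int (u p) = (of_int (u (p - 1)) + of_int (b (p - 1)) - of_int (c p) :: 'a)"
      by simp
    have "(1 - t) * (\<Sum>n\<in>{0<..<p}. of_int (u n) * t ^ n) =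
      t * (\<Sum>n\<in>{0<..<p}. of_int (b n) * t ^ n) - (\<Sum>n\<in>{0<..<p}. of_int (c n) * t ^ n)
      + of_int (u 1 + c 1) * t - of_int (u (p - 1) + b (p - 1)) * t ^ p"
      using step.IH step.prems by simp
    then show ?case
      using step.hyps by (simp add: greaterThanLessThan_Suc_nat u' algebra_simps)
  qed
qed

lemma gen_one: "(1 - t_adelic) * gen (\<lambda>_ _. 1) = t_adelic - t_bold_p"
  unfolding t_adelic_def t_bold_p_def gen_def one_adelic_def minus_adelic.abs_eq times_adelic.abs_eq
proof (rule abs_adelic_eqI)
  fix p :: nat assume "p > 3"
  then have "(1 - t_var) * gen_poly (\<lambda>_ _. 1) p = t_var - t_var ^ p"
    using summation_by_parts[of p "\<lambda>_. 1" "\<lambda>_. 0" "\<lambda>_. 0" t_var] by (simp add: gen_poly_def)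
  then show "of_nat p dvd (1 - t_var) * gen_poly (\<lambda>_ _. 1) p - (t_var - t_var ^ p)" by simp
qed

text \<open>
  The full sum of \<open>a\<close> is the boundary term at the upper end, where it multiplies \<open>t\<^sup>p\<close>; at the
  lower end the inner sum is empty.
\<close>

lemma gen_sum_below:
  assumes "\<And>p. prime p \<Longrightarrow> p > 3 \<Longrightarrow> int p dvd (\<Sum>n\<in>{0<..<p}. a p n)"
  shows "(1 - t_adelic) * gen (sum_below a) = t_adelic * gen a"
  unfolding t_adelic_def gen_def one_adelic_def minus_adelic.abs_eq times_adelic.abs_eq
proof (rule abs_adelic_eqI)
  fix p :: nat assume p: "prime p" "p > 3"
  have S: "sum_below a p (Suc n) = a p n + sum_below a p n" if "n > 0" for n
    using that by (simp add: sum_below_def greaterThanLessThan_Suc_nat)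
  have "sum_below a p (p - 1) + a p (p - 1) = (\<Sum>n\<in>{0<..<p}. a p n)"
    using S[of "p - 1"] p by (simp add: sum_below_def)
  moreover have "sum_below a p 1 = 0" by (simp add: sum_below_def)
  ultimately have "(1 - t_var) * gen_poly (sum_below a) p - t_var * gen_poly a p
      = - (of_int (\<Sum>n\<in>{0<..<p}. a p n) * t_var ^ p)"
    using summation_by_parts[of p "sum_below a p" "a p" "\<lambda>_. 0" t_var] p S by (simp add: gen_poly_def)
  moreover have "of_nat p dvd of_int (\<Sum>n\<in>{0<..<p}. a p n) * t_var ^ p"
    by (intro dvd_of_int_mult assms p)
  ultimately show "of_nat p dvd (1 - t_var) * gen_poly (sum_below a) p - t_var * gen_poly a p"
    by (simp only: dvd_minus_iff)
qed

lemma sum_above_Suc: "Suc n < p \<Longrightarrow> sum_above a p n = a p (Suc n) + sum_above a p (Suc n)"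
proof -
  assume "Suc n < p"
  then have "{n<..<p} = insert (Suc n) {Suc n<..<p}" by auto
  then show ?thesis by (simp add: sum_above_def)
qed

text \<open>
  Here the full sum of \<open>a\<close> is the boundary term at the lower end, where it multiplies \<open>t\<close>.
\<close>

lemma gen_sum_above:
  assumes "\<And>p. prime p \<Longrightarrow> p > 3 \<Longrightarrow> int p dvd (\<Sum>n\<in>{0<..<p}. a p n)"
  shows "(1 - t_adelic) * gen (sum_above a) = - gen a"
  unfolding t_adelic_def gen_def one_adelic_def minus_adelic.abs_eq times_adelic.abs_eq uminus_adelic.abs_eq
proof (rule abs_adelic_eqI)
  fix p :: nat assume p: "prime p" "p > 3"
  have "sum_above a p 1 + a p 1 = (\<Sum>n\<in>{0<..<p}. a p n)"
    using sum_above_Suc[of 0 p a] p by (simp add: sum_above_def)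
  moreover have "{p - 1<..<p} = {}" by auto
  then have "sum_above a p (p - 1) = 0" by (simp add: sum_above_def)
  ultimately have "(1 - t_var) * gen_poly (sum_above a) p - - gen_poly a p
      = of_int (\<Sum>n\<in>{0<..<p}. a p n) * t_var"
    using summation_by_parts[of p "sum_above a p" "\<lambda>_. 0" "a p" t_var] p sum_above_Suc[of _ p a]
    by (simp add: gen_poly_def)
  then show "of_nat p dvd (1 - t_var) * gen_poly (sum_above a) p - - gen_poly a p"
    using dvd_of_int_mult[OF assms[OF p], of t_var] by (simp only:)
qed

text \<open>
  The discrete product rule.  The boundary terms vanish because one of the two factors is an empty
  sum at either end.
\<close>

lemma gen_sum_below_above:
  "(1 - t_adelic) * gen (\<lambda>p n. sum_below a p n * sum_above b p n) =
   t_adelic * gen (\<lambda>p n. a p n * sum_above b p n) - gen (\<lambda>p n. b p n * sum_below a p n)"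
  unfolding t_adelic_def gen_def one_adelic_def minus_adelic.abs_eq times_adelic.abs_eq
proof (rule abs_adelic_eqI)
  fix p :: nat assume p: "prime p" "p > 3"
  have B: "sum_below a p (Suc n) = a p n + sum_below a p n" if "n > 0" for n
    using that by (simp add: sum_below_def greaterThanLessThan_Suc_nat)
  have "sum_below a p 1 = 0" by (simp add: sum_below_def)
  moreover have "{p - 1<..<p} = {}" by auto
  then have "sum_above b p (p - 1) = 0" by (simp add: sum_above_def)
  ultimately have "(1 - t_var) * gen_poly (\<lambda>p n. sum_below a p n * sum_above b p n) p =
      t_var * gen_poly (\<lambda>p n. a p n * sum_above b p n) p - gen_poly (\<lambda>p n. b p n * sum_below a p n) p"
    using summation_by_parts[of p "\<lambda>n. sum_below a p n * sum_above b p n" "\<lambda>n. a p n * sum_above b p n"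
        "\<lambda>n. b p n * sum_below a p n" t_var] p B sum_above_Suc[of _ p b]
    by (simp add: gen_poly_def algebra_simps)
  then show "of_nat p dvd (1 - t_var) * gen_poly (\<lambda>p n. sum_below a p n * sum_above b p n) p
      - (t_var * gen_poly (\<lambda>p n. a p n * sum_above b p n) p - gen_poly (\<lambda>p n. b p n * sum_below a p n) p)"
    by simp
qed

lemma coprime_int_prime: "prime p \<Longrightarrow> 0 < n \<Longrightarrow> n < p \<Longrightarrow> coprime (int n) (int p)"
  using prime_nat_not_dvd
  by (metis coprime_commute coprime_int_iff dvd_imp_le leD prime_imp_coprime_nat)

lemma inv_mod_cong:
  assumes "prime p" "0 < n" "n < p"
  shows "[int n * inv_mod p n = 1] (mod int p)"
  unfolding inv_mod_def by (intro cong_modular_inverse1 coprime_int_prime assms)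

text \<open>
  The operator \<open>t d/dt\<close> multiplies the coefficient of \<open>t\<^sup>n\<close> by \<open>n\<close>, which cancels the division by \<open>n\<close>.
\<close>

lemma deriv_gen_over: "deriv_adelic (gen (over a)) = (1 - t_adelic) * gen a"
  unfolding t_adelic_def gen_def one_adelic_def minus_adelic.abs_eq times_adelic.abs_eq deriv_adelic.abs_eq
proof (rule abs_adelic_eqI)
  fix p :: nat assume p: "prime p" "p > 3"
  have m: "t_var * pderiv (of_int c * t_var ^ n) = of_int (int n * c) * t_var ^ n" for c n
  proof -
    have "pderiv t_var = 1" "pderiv (of_int c :: int poly) = 0"
      by (simp_all add: t_var_def pderiv_pCons of_int_poly)
    then have "pderiv (of_int c * t_var ^ n) = of_int c * (of_nat n * t_var ^ (n - 1))"
      by (simp add: pderiv_mult pderiv_power of_nat_poly)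
    then show ?thesis by (cases n) (simp_all add: algebra_simps)
  qed
  have ps: "pderiv (sum f A) = (\<Sum>x\<in>A. pderiv (f x))" for f :: "nat \<Rightarrow> int poly" and A
    by (induction A rule: infinite_finite_induct) (simp_all add: pderiv_add)
  have "t_var * pderiv (gen_poly (over a) p) - gen_poly a p
      = (\<Sum>n\<in>{0<..<p}. of_int ((int n * inv_mod p n - 1) * a p n) * t_var ^ n)"
    unfolding gen_poly_def ps sum_distrib_left m sum_subtractf[symmetric]
    by (intro sum.cong) (simp_all add: over_def algebra_simps)
  also have "of_nat p dvd \<dots>"
  proof (intro dvd_sum dvd_of_int_mult dvd_mult2)
    fix n assume "n \<in> {0<..<p}"
    then show "int p dvd int n * inv_mod p n - 1"
      using inv_mod_cong[of p n] p by (auto simp: cong_iff_dvd_diff)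
  qed
  finally have "of_nat p dvd (1 - t_var) * (t_var * pderiv (gen_poly (over a) p) - gen_poly a p)"
    by simp
  then show "of_nat p dvd t_var * (1 - t_var) * pderiv (gen_poly (over a) p) - (1 - t_var) * gen_poly a p"
    by (simp add: algebra_simps)
qed

section \<open>Congruences for harmonic sums\<close>

text \<open>
  The substitution \<open>n \<mapsto> p - n\<close> is \<open>n \<mapsto> - n\<close> modulo \<open>p\<close>.  It exchanges sums below and above, and each
  division by the index contributes a sign.  The sign is kept as an explicit factor \<open>s\<close> in the
  following rules, so that they compose along nested sums; this accounts for the form \<open>- 1 * _\<close>.
\<close>

lemma inv_mod_reflect:
  assumes p: "prime p" and n: "0 < n" "n < p"
  shows "[inv_mod p (p - n) = - 1 * inv_mod p n] (mod int p)"
proof -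
  have "[int (p - n) * inv_mod p (p - n) = 1] (mod int p)"
    using n by (intro inv_mod_cong p) auto
  then obtain k where k: "int p * k = (int p - int n) * inv_mod p (p - n) - 1"
    using n by (metis cong_iff_dvd_diff dvdE nat_less_le of_nat_diff)
  obtain l where l: "int p * l = int n * inv_mod p n - 1"
    using inv_mod_cong[OF assms] by (metis cong_iff_dvd_diff dvdE)
  have "int n * (inv_mod p (p - n) - - 1 * inv_mod p n) = int p * (l - k + inv_mod p (p - n))"
    using k l by (simp add: algebra_simps)
  then have "int p dvd int n * (inv_mod p (p - n) - - 1 * inv_mod p n)" by simp
  moreover have "coprime (int p) (int n)" using coprime_int_prime[OF assms] by (simp add: coprime_commute)
  ultimately show ?thesis
    unfolding cong_iff_dvd_diff by (simp only: coprime_dvd_mult_right_iff)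
qed

lemma over_reflect:
  assumes "prime p" "0 < n" "n < p" and "[a p (p - n) = s * b p n] (mod int p)"
  shows "[over a p (p - n) = - s * over b p n] (mod int p)"
  using cong_mult[OF inv_mod_reflect[OF assms(1-3)] assms(4)] by (simp add: over_def mult_ac)

lemma sum_below_reflect:
  assumes n: "n < p" and "\<And>m. 0 < m \<Longrightarrow> m < p \<Longrightarrow> [a p (p - m) = s * b p m] (mod int p)"
  shows "[sum_below a p (p - n) = s * sum_above b p n] (mod int p)"
proof -
  have "sum_below a p (p - n) = (\<Sum>m\<in>{n<..<p}. a p (p - m))"
    unfolding sum_below_def using n
    by (intro sum.reindex_bij_witness[of _ "\<lambda>m. p - m" "\<lambda>m. p - m"]) auto
  also have "[\<dots> = (\<Sum>m\<in>{n<..<p}. s * b p m)] (mod int p)"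
    by (intro cong_sum assms(2)) auto
  finally show ?thesis by (simp add: sum_above_def sum_distrib_left)
qed

lemma sum_above_reflect:
  assumes n: "0 < n" "n < p" and "\<And>m. 0 < m \<Longrightarrow> m < p \<Longrightarrow> [a p (p - m) = s * b p m] (mod int p)"
  shows "[sum_above a p (p - n) = s * sum_below b p n] (mod int p)"
proof -
  have "sum_above a p (p - n) = (\<Sum>m\<in>{0<..<n}. a p (p - m))"
    unfolding sum_above_def using n
    by (intro sum.reindex_bij_witness[of _ "\<lambda>m. p - m" "\<lambda>m. p - m"]) auto
  also have "[\<dots> = (\<Sum>m\<in>{0<..<n}. s * b p m)] (mod int p)"
    using n by (intro cong_sum assms(3)) auto
  finally show ?thesis by (simp add: sum_below_def sum_distrib_left)
qed

lemma sum_dvd_if_odd: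
  assumes p: "odd p" and "\<And>n. 0 < n \<Longrightarrow> n < p \<Longrightarrow> [f (p - n) = - f n] (mod int p)"
  shows "int p dvd (\<Sum>n\<in>{0<..<p}. f n)"
proof -
  have "(\<Sum>n\<in>{0<..<p}. f n) = (\<Sum>n\<in>{0<..<p}. f (p - n))"
    by (intro sum.reindex_bij_witness[of _ "\<lambda>m. p - m" "\<lambda>m. p - m"]) auto
  also have "[\<dots> = (\<Sum>n\<in>{0<..<p}. - f n)] (mod int p)"
    by (intro cong_sum assms(2)) auto
  finally have "int p dvd 2 * (\<Sum>n\<in>{0<..<p}. f n)"
    by (simp add: cong_iff_dvd_diff sum_negf)
  moreover have "coprime (int p) 2" using p by simp
  ultimately show ?thesis by (simp only: coprime_dvd_mult_right_iff)
qed

lemma sum_inv_mod: "prime p \<Longrightarrow> p > 3 \<Longrightarrow> int p dvd (\<Sum>n\<in>{0<..<p}. inv_mod p n)"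
  using inv_mod_reflect[of p] by (intro sum_dvd_if_odd prime_odd_nat) auto

lemma sum_triangle_swap:
  "(\<Sum>n\<in>{0<..<p}. \<Sum>m\<in>{0<..<n}. g m n) = (\<Sum>m\<in>{0<..<p}. \<Sum>n\<in>{m<..<p}. g m n)"
  for g :: "nat \<Rightarrow> nat \<Rightarrow> 'a::comm_monoid_add" and p :: nat
  unfolding sum.Sigma[OF finite_greaterThanLessThan ballI[OF finite_greaterThanLessThan]]
  by (intro sum.reindex_bij_witness[of _ "\<lambda>(m, n). (n, m)" "\<lambda>(n, m). (m, n)"]) auto

text \<open>
  Six times the sum is \<open>(p - 1) p (2 p - 1)\<close>.
\<close>

lemma sum_squares_dvd:
  assumes p: "prime p" "p > 3"
  shows "int p dvd (\<Sum>n\<in>{0<..<p}. int n ^ 2)"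
proof -
  have "6 * (\<Sum>n\<in>{0<..<Suc k}. int n ^ 2) = int k * (int k + 1) * (2 * int k + 1)" for k
  proof (induction k)
    case 0
    show ?case by simp
  next
    case (Suc k)
    then show ?case by (simp add: greaterThanLessThan_Suc_nat[of "Suc k"] algebra_simps power2_eq_square)
  qed
  from this[of "p - 1"] have "int p dvd 6 * (\<Sum>n\<in>{0<..<p}. int n ^ 2)" using p by simp
  moreover have "coprime (int p) 6"
  proof -
    have "coprime p 2" "coprime p 3"
      using p prime_odd_nat[of p] by (auto intro!: primes_coprime)
    then have "coprime p (2 * 3)" by (simp only: coprime_mult_right_iff)
    then have "coprime (int p) (int 6)" by (simp only: coprime_int_iff) simp
    then show ?thesis by simp
  qed
  ultimately show ?thesis by (simp only: coprime_dvd_mult_right_iff)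
qed

text \<open>
  Inversion permutes the nonzero residues, so inverse squares can be replaced by squares.
\<close>

lemma sum_inv_mod_squares:
  assumes p: "prime p" "p > 3"
  shows "int p dvd (\<Sum>n\<in>{0<..<p}. inv_mod p n ^ 2)"
proof -
  have r: "nat (inv_mod p n) \<in> {0<..<p} \<and> nat (inv_mod p (nat (inv_mod p n))) = n
      \<and> int (nat (inv_mod p n)) = inv_mod p n" if n: "n \<in> {0<..<p}" for n
  proof -
    have c: "coprime (int n) (int p)" using n p by (intro coprime_int_prime) auto
    have 1: "inv_mod p n > 0" "inv_mod p n < int p"
      unfolding inv_mod_def using p c by (auto intro: mult_modular_inverse_int_pos modular_inverse_int_less)
    have "modular_inverse (int p) (inv_mod p n) = int n"
      using n inv_mod_cong[OF p(1), of n] by (intro modular_inverse_int_eqI) (auto simp: mult.commute)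
    then show ?thesis using 1 by (simp add: inv_mod_def)
  qed
  have "(\<Sum>n\<in>{0<..<p}. inv_mod p n ^ 2) = (\<Sum>n\<in>{0<..<p}. int n ^ 2)"
    by (rule sum.reindex_bij_witness[of _ "\<lambda>n. nat (inv_mod p n)" "\<lambda>n. nat (inv_mod p n)"])
      (use r in auto)
  then show ?thesis using sum_squares_dvd[OF p] by simp
qed

text \<open>
  Twice the double sum is \<open>(\<Sum> 1/n)\<^sup>2 - \<Sum> 1/n\<^sup>2\<close>.  The reflection \<open>n \<mapsto> p - n\<close> is of no help
  here, because a sum of even weight does not change sign under it.
\<close>

lemma sum_over_below_inv_mod:
  assumes p: "prime p" "p > 3"
  shows "int p dvd (\<Sum>n\<in>{0<..<p}. over (sum_below inv_mod) p n)"
    and "int p dvd (\<Sum>n\<in>{0<..<p}. over (sum_above inv_mod) p n)"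
proof -
  let ?S = "\<Sum>n\<in>{0<..<p}. over (sum_below inv_mod) p n" and ?Z = "\<Sum>n\<in>{0<..<p}. inv_mod p n"
  have swap: "(\<Sum>n\<in>{0<..<p}. over (sum_above inv_mod) p n) = ?S"
    unfolding over_def sum_below_def sum_above_def sum_distrib_left sum_triangle_swap
    by (simp add: mult.commute)
  have split: "inv_mod p n + sum_below inv_mod p n + sum_above inv_mod p n = ?Z" if "n \<in> {0<..<p}" for n
  proof -
    have "{0<..<p} = insert n ({0<..<n} \<union> {n<..<p})" using that by auto
    moreover have "sum (inv_mod p) ({0<..<n} \<union> {n<..<p}) = sum_below inv_mod p n + sum_above inv_mod p n"
      unfolding sum_below_def sum_above_def by (intro sum.union_disjoint) auto
    ultimately show ?thesis by simp
  qed
  have "?Z * ?Z = (\<Sum>n\<in>{0<..<p}. inv_mod p n * (inv_mod p n + sum_below inv_mod p n + sum_above inv_mod p n))"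
    unfolding sum_distrib_right by (intro sum.cong) (simp_all only: split)
  also have "\<dots> = (\<Sum>n\<in>{0<..<p}. inv_mod p n ^ 2) + 2 * ?S"
    using swap by (simp add: distrib_left sum.distrib power2_eq_square over_def)
  finally have "2 * ?S = ?Z * ?Z - (\<Sum>n\<in>{0<..<p}. inv_mod p n ^ 2)" by simp
  then have "int p dvd 2 * ?S"
    using sum_inv_mod[OF p] sum_inv_mod_squares[OF p] by simp
  moreover have "coprime (int p) 2" using p prime_odd_nat[of p] by simp
  ultimately show "int p dvd ?S" by (simp only: coprime_dvd_mult_right_iff)
  then show "int p dvd (\<Sum>n\<in>{0<..<p}. over (sum_above inv_mod) p n)" by (simp only: swap)
qed


section \<open>The polylogarithms as generating polynomials\<close>

text \<open>
  Splitting off the largest entry \<open>n\<close> leaves a tuple below \<open>n\<close>, which is again of the form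
  \<open>index_tuples r n\<close>.
\<close>

lemma sum_index_tuples_Suc:
  "(\<Sum>ns\<in>index_tuples (Suc r) p. f ns) = (\<Sum>n\<in>{0<..<p}. \<Sum>ms\<in>index_tuples r n. f (ms @ [n]))"
proof -
  have fin: "finite (index_tuples r n)" for n
    unfolding index_tuples_def
    by (rule finite_subset[OF _ finite_lists_length_eq[of "{0<..<n}" r]]) auto
  have decomp: "butlast ns @ [last ns] = ns" if "ns \<in> index_tuples (Suc r) p" for ns
    using that by (intro append_butlast_last_id) (auto simp: index_tuples_def)
  have mem: "ms @ [n] \<in> index_tuples (Suc r) p \<longleftrightarrow> n \<in> {0<..<p} \<and> ms \<in> index_tuples r n" for ms n
    by (fastforce simp: index_tuples_def sorted_wrt_append)
  show ?thesis
    unfolding sum.Sigma[OF finite_greaterThanLessThan ballI[OF fin]]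
  proof (rule sum.reindex_bij_witness[of _ "\<lambda>(n, ms). ms @ [n]" "\<lambda>ns. (last ns, butlast ns)"])
    fix ns assume ns: "ns \<in> index_tuples (Suc r) p"
    then show "(last ns, butlast ns) \<in> (SIGMA n:{0<..<p}. index_tuples r n)"
      using mem[of "butlast ns" "last ns"] by (simp add: decomp)
  qed (auto simp: decomp mem)
qed

lemma index_tuples_0 [simp]: "index_tuples 0 p = {[]}"
  by (auto simp: index_tuples_def)

lemma polylog_component_2:
  "polylog_component [k, l] x p = (\<Sum>b\<in>{0<..<p}. \<Sum>a\<in>{0<..<b}.
     of_int (inv_mod p a ^ k * inv_mod p b ^ l) * (x 0 ^ a * x 1 ^ b))"
  by (simp add: polylog_component_def sum_index_tuples_Suc inv_mod_def lessThan_Suc mult_ac)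

lemma polylog_component_3:
  "polylog_component [k, l, m] x p = (\<Sum>c\<in>{0<..<p}. \<Sum>b\<in>{0<..<c}. \<Sum>a\<in>{0<..<b}.
     of_int (inv_mod p a ^ k * inv_mod p b ^ l * inv_mod p c ^ m) * (x 0 ^ a * x 1 ^ b * x 2 ^ c))"
  by (simp add: polylog_component_def sum_index_tuples_Suc inv_mod_def lessThan_Suc mult_ac
      numeral_2_eq_2)

lemma polylog_star_eq_gen:
  assumes "\<And>p. polylog_component ks ((!) xs) p = gen_poly a p"
  shows "polylog_star ks xs = gen a"
  using ext[of "polylog_component ks ((!) xs)" "gen_poly a", OF assms]
  by (simp add: polylog_star_eq gen_def)

lemma polylog_111: "polylog [1,1,1] t_var = gen (over (sum_below (over (sum_below inv_mod))))"
proof -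
  have "polylog_star [1,1,1] [1, 1, t_var] = gen (over (sum_below (over (sum_below inv_mod))))"
    by (rule polylog_star_eq_gen)
      (simp add: polylog_component_3 numeral_2_eq_2 gen_poly_def over_def sum_below_def
        sum_distrib_left sum_distrib_right mult_ac)
  then show ?thesis by (simp add: polylog_def numeral_2_eq_2)
qed

text \<open>
  The variable sits at the smallest index, so two exchanges of summation bring that index outermost.
\<close>

lemma polylog_tilde_111: "polylog_tilde [1,1,1] t_var = gen (over (sum_above (over (sum_above inv_mod))))"
proof -
  have "polylog_star [1,1,1] [t_var, 1, 1] = gen (over (sum_above (over (sum_above inv_mod))))"
  proof (rule polylog_star_eq_gen)
    fix p
    let ?f = "\<lambda>a b c. of_int (inv_mod p a * inv_mod p b * inv_mod p c) * t_var ^ a"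
    have "polylog_component [1,1,1] ((!) [t_var, 1, 1]) p
      = (\<Sum>c\<in>{0<..<p}. \<Sum>b\<in>{0<..<c}. \<Sum>a\<in>{0<..<b}. ?f a b c)"
      by (simp add: polylog_component_3 numeral_2_eq_2)
    also have "\<dots> = (\<Sum>b\<in>{0<..<p}. \<Sum>c\<in>{b<..<p}. \<Sum>a\<in>{0<..<b}. ?f a b c)"
      by (rule sum_triangle_swap)
    also have "\<dots> = (\<Sum>b\<in>{0<..<p}. \<Sum>a\<in>{0<..<b}. \<Sum>c\<in>{b<..<p}. ?f a b c)"
      by (rule sum.cong[OF refl], rule sum.swap)
    also have "\<dots> = (\<Sum>a\<in>{0<..<p}. \<Sum>b\<in>{a<..<p}. \<Sum>c\<in>{b<..<p}. ?f a b c)"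
      by (rule sum_triangle_swap)
    also have "\<dots> = gen_poly (over (sum_above (over (sum_above inv_mod)))) p"
      by (simp add: gen_poly_def over_def sum_above_def sum_distrib_left sum_distrib_right mult_ac)
    finally show "polylog_component [1,1,1] ((!) [t_var, 1, 1]) p =
      gen_poly (over (sum_above (over (sum_above inv_mod)))) p" .
  qed
  then show ?thesis by (simp add: polylog_tilde_def numeral_2_eq_2)
qed

lemma polylog_star_111:
  "polylog_star [1,1,1] [1, t_var, 1] = gen (over (\<lambda>p n. sum_below inv_mod p n * sum_above inv_mod p n))"
proof (rule polylog_star_eq_gen)
  fix p
  let ?f = "\<lambda>a b c. of_int (inv_mod p a * inv_mod p b * inv_mod p c) * t_var ^ b"
  have "polylog_component [1,1,1] ((!) [1, t_var, 1]) p
    = (\<Sum>c\<in>{0<..<p}. \<Sum>b\<in>{0<..<c}. \<Sum>a\<in>{0<..<b}. ?f a b c)"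
    by (simp add: polylog_component_3 numeral_2_eq_2)
  also have "\<dots> = (\<Sum>b\<in>{0<..<p}. \<Sum>c\<in>{b<..<p}. \<Sum>a\<in>{0<..<b}. ?f a b c)"
    by (rule sum_triangle_swap)
  also have "\<dots> = (\<Sum>b\<in>{0<..<p}. \<Sum>a\<in>{0<..<b}. \<Sum>c\<in>{b<..<p}. ?f a b c)"
    by (rule sum.cong[OF refl], rule sum.swap)
  also have "\<dots> = gen_poly (over (\<lambda>p n. sum_below inv_mod p n * sum_above inv_mod p n)) p"
    by (simp add: gen_poly_def over_def sum_below_def sum_above_def sum_product
        sum_distrib_left sum_distrib_right mult_ac)
  finally show "polylog_component [1,1,1] ((!) [1, t_var, 1]) p =
    gen_poly (over (\<lambda>p n. sum_below inv_mod p n * sum_above inv_mod p n)) p" .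
qed

lemma polylog_12: "polylog [1,2] t_var = gen (over (over (sum_below inv_mod)))"
proof -
  have "polylog_star [1,2] [1, t_var] = gen (over (over (sum_below inv_mod)))"
    by (rule polylog_star_eq_gen)
      (simp add: polylog_component_2 gen_poly_def over_def sum_below_def power2_eq_square
        sum_distrib_left sum_distrib_right mult_ac)
  then show ?thesis by (simp add: polylog_def)
qed

lemma polylog_tilde_21: "polylog_tilde [2,1] t_var = gen (over (over (sum_above inv_mod)))"
proof -
  have "polylog_star [2,1] [t_var, 1] = gen (over (over (sum_above inv_mod)))"
    by (rule polylog_star_eq_gen, subst polylog_component_2, subst sum_triangle_swap)
      (simp add: gen_poly_def over_def sum_above_def power2_eq_square
        sum_distrib_left sum_distrib_right mult_ac)
  then show ?thesis by (simp add: polylog_tilde_def)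
qed

lemma reflect_polylog_star:
  assumes "length xs = length ks"
  shows "reflect (polylog_star ks xs) = polylog_star ks (map (\<lambda>x. pcompose x (1 - t_var)) xs)"
proof -
  have "pcompose (polylog_component ks ((!) xs) p) (1 - t_var) =
      polylog_component ks ((!) (map (\<lambda>x. pcompose x (1 - t_var)) xs)) p" for p
    unfolding polylog_component_def pcompose_sum pcompose_prod
    by (intro sum.cong prod.cong refl)
      (use assms in \<open>simp add: pcompose_smult of_int_poly pcompose_power flip: of_int_power\<close>)
  then show ?thesis by (simp add: polylog_star_eq reflect.abs_eq)
qed

section \<open>Invariance under reflection\<close>

lemma degree_gen_poly: "degree (gen_poly a p) \<le> p - 1"
  unfolding gen_poly_def
proof (rule degree_sum_le)
  fix n assume "n \<in> {0<..<p}"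
  then show "degree (of_int (a p n) * t_var ^ n) \<le> p - 1"
    by (auto simp: t_var_def of_int_poly degree_linear_power monom_altdef[of 1, symmetric] degree_monom_eq
        intro!: order.trans[OF degree_smult_le])
qed simp

lemma poly_gen_poly_0: "poly (gen_poly a p) 0 = 0"
  by (auto simp: gen_poly_def poly_sum t_var_def intro!: sum.neutral)

lemma poly_gen_poly_1: "poly (gen_poly a p) 1 = (\<Sum>n\<in>{0<..<p}. a p n)"
  by (simp add: gen_poly_def poly_sum t_var_def of_int_poly)

lemma over_one: "over (\<lambda>_ _. 1) = inv_mod"
  by (simp add: over_def fun_eq_iff)

lemma deriv_gen_inv_mod: "deriv_adelic (gen inv_mod) = t_adelic - t_bold_p"
  using deriv_gen_over[of "\<lambda>_ _. 1"] by (simp add: gen_one over_one)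

lemma reflect_gen_inv_mod: "reflect (gen inv_mod) = gen inv_mod"
proof (rule reflect_eqI[where N = 1])
  show "gen inv_mod = abs_adelic (gen_poly inv_mod)" by (rule gen_def)
  show "deriv_adelic (gen inv_mod) = (t_adelic - t_bold_p) * 1" by (simp add: deriv_gen_inv_mod)
  fix p :: nat assume "prime p" "p > 3"
  then show "degree (gen_poly inv_mod p) < 3 * p"
    using degree_gen_poly[of inv_mod p] by linarith
  show "int p dvd poly (gen_poly inv_mod p) 1"
    using \<open>prime p\<close> \<open>p > 3\<close> by (simp add: poly_gen_poly_1 sum_inv_mod)
qed (simp_all add: poly_gen_poly_0)

lemma deriv_gen_over_below_inv: "deriv_adelic (gen (over (sum_below inv_mod))) = t_adelic * gen inv_mod"
  by (simp add: deriv_gen_over gen_sum_below sum_inv_mod)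

lemma deriv_gen_over_above_inv: "deriv_adelic (gen (over (sum_above inv_mod))) = - gen inv_mod"
  by (simp add: deriv_gen_over gen_sum_above sum_inv_mod)

lemma degree_t_power: "degree (t_var ^ n) = n"
  by (simp add: t_var_def degree_linear_power)

text \<open>
  Modulo \<open>p\<close> this is half the square of \<open>gen inv_mod\<close>, just as the classical double logarithm is half
  the square of \<open>- log (1 - t)\<close>: the second summand collects the products of \<open>t\<^sup>i / i\<close> and
  \<open>t\<^sup>j / j\<close> with \<open>i + j > p\<close>.
\<close>

definition weight_two :: "int poly adelic" where
  "weight_two = gen (over (sum_below inv_mod)) + t_bold_p * gen (over (sum_above inv_mod))"

lemma reflect_weight_two: "reflect weight_two = weight_two"
proof (rule reflect_eqI[OF _ _ reflect_gen_inv_mod])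
  let ?g = "\<lambda>p. gen_poly (over (sum_below inv_mod)) p + t_var ^ p * gen_poly (over (sum_above inv_mod)) p"
  show "weight_two = abs_adelic ?g"
    by (simp add: weight_two_def gen_def t_bold_p_def times_adelic.abs_eq plus_adelic.abs_eq)
  show "deriv_adelic weight_two = (t_adelic - t_bold_p) * gen inv_mod"
    by (simp add: weight_two_def deriv_adelic_add deriv_adelic_mult deriv_gen_over_below_inv
        deriv_gen_over_above_inv algebra_simps)
  fix p :: nat assume p: "prime p" "p > 3"
  have "degree (t_var ^ p * gen_poly (over (sum_above inv_mod)) p) \<le> p + (p - 1)"
    by (rule order.trans[OF degree_mult_le])
      (use degree_gen_poly[of "over (sum_above inv_mod)" p] in \<open>simp add: degree_t_power\<close>)
  then have "degree (?g p) \<le> p + (p - 1)"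
    by (intro degree_add_le) (auto intro: order.trans[OF degree_gen_poly])
  then show "degree (?g p) < 3 * p" using p by linarith
  show "int p dvd poly (?g p) 0" using p by (simp add: poly_gen_poly_0)
  show "int p dvd poly (?g p) 1"
    using sum_over_below_inv_mod[OF p] by (simp add: poly_gen_poly_1 t_var_def)
qed

definition weight_three :: "int poly adelic" where
  "weight_three = (1 + t_bold_p) * polylog [1,1,1] t_var
   + t_bold_p * (1 + t_bold_p) * polylog_tilde [1,1,1] t_var
   + 2 * t_bold_p * polylog_star [1,1,1] [1, t_var, 1]
   + t_bold_p * polylog [1,2] t_var
   + t_bold_p * polylog_tilde [2,1] t_var"

text \<open>
  Since \<open>\<A>\<^sub>R\<close> can be the zero ring, it has no instance of \<^class>\<open>comm_semiring_1\<close>, and the general laws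
  for numerals do not apply to it.
\<close>

lemma two_adelic: "(2 :: 'a::comm_ring_1 adelic) = 1 + 1"
  by (simp add: one_add_one)

text \<open>
  In the sum, the coefficients of the two parts of \<open>weight_two\<close> are \<open>t - T\<close> and \<open>T (t - T)\<close> with
  \<open>T = t\<^sup>p\<close>; the polylogarithms with an index 2 supply \<open>T (1 - t)\<close> to each, which makes both
  coefficients divisible by \<open>t - T\<close>.
\<close>

lemma deriv_weight_three: "deriv_adelic weight_three = (t_adelic - t_bold_p) * weight_two"
proof -
  have 1: "deriv_adelic (polylog [1,1,1] t_var) = t_adelic * gen (over (sum_below inv_mod))"
    unfolding polylog_111 deriv_gen_over by (intro gen_sum_below sum_over_below_inv_mod)
  have 2: "deriv_adelic (polylog_tilde [1,1,1] t_var) = - gen (over (sum_above inv_mod))"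
    unfolding polylog_tilde_111 deriv_gen_over by (intro gen_sum_above sum_over_below_inv_mod)
  have 3: "deriv_adelic (polylog_star [1,1,1] [1, t_var, 1])
      = t_adelic * gen (over (sum_above inv_mod)) - gen (over (sum_below inv_mod))"
    unfolding polylog_star_111 deriv_gen_over gen_sum_below_above by (simp add: over_def[abs_def])
  have 4: "deriv_adelic (polylog [1,2] t_var) = (1 - t_adelic) * gen (over (sum_below inv_mod))"
    unfolding polylog_12 deriv_gen_over ..
  have 5: "deriv_adelic (polylog_tilde [2,1] t_var) = (1 - t_adelic) * gen (over (sum_above inv_mod))"
    unfolding polylog_tilde_21 deriv_gen_over ..
  show ?thesis
    unfolding weight_three_def weight_two_def two_adelic
    by (simp only: deriv_adelic_add deriv_adelic_mult 1 2 3 4 5 deriv_adelic_1 deriv_adelic_t_bold_p)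
      (simp add: algebra_simps del: one_add_one)
qed

text \<open>
  The value at \<open>t = 1\<close> is a sum of odd weight.  Its summands are permuted up to sign by
  \<open>n \<mapsto> p - n\<close>: the first two terms are exchanged, so are the last two, and the middle one
  is mapped to its negative.
\<close>

lemma reflect_weight_three: "reflect weight_three = weight_three"
proof (rule reflect_eqI[OF _ deriv_weight_three reflect_weight_two])
  let ?a = "over (sum_below (over (sum_below inv_mod)))" and ?b = "over (sum_above (over (sum_above inv_mod)))"
    and ?c = "over (\<lambda>p n. sum_below inv_mod p n * sum_above inv_mod p n)"
    and ?d = "over (over (sum_below inv_mod))" and ?e = "over (over (sum_above inv_mod))"
  let ?T = "\<lambda>p. t_var ^ p"
  let ?g = "\<lambda>p. (1 + ?T p) * gen_poly ?a p + ?T p * (1 + ?T p) * gen_poly ?b p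
    + 2 * ?T p * gen_poly ?c p + ?T p * gen_poly ?d p + ?T p * gen_poly ?e p"
  show "weight_three = abs_adelic ?g"
    unfolding weight_three_def polylog_111 polylog_tilde_111 polylog_star_111 polylog_12 polylog_tilde_21
      two_adelic one_add_one[where 'a = "int poly", symmetric]
    by (simp only: gen_def t_bold_p_def one_adelic_def times_adelic.abs_eq plus_adelic.abs_eq)
  fix p :: nat assume p: "prime p" "p > 3"
  have T: "degree (1 + ?T p) \<le> p" "degree (2 * ?T p) \<le> p"
    by (auto intro!: degree_add_le order.trans[OF degree_mult_le] simp: degree_t_power)
  have M: "degree (x * gen_poly u p) \<le> 2 * p + (p - 1)" if "degree x \<le> 2 * p" for x u
    by (rule order.trans[OF degree_mult_le]) (use that degree_gen_poly[of u p] in linarith)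
  have "degree (?T p * (1 + ?T p)) \<le> 2 * p"
    by (rule order.trans[OF degree_mult_le]) (use T in \<open>simp add: degree_t_power\<close>)
  then have "degree (?g p) \<le> 2 * p + (p - 1)"
    using T by (intro degree_add_le M) (auto simp: degree_t_power)
  then show "degree (?g p) < 3 * p" using p by linarith
  show "int p dvd poly (?g p) 0" using p by (simp add: poly_gen_poly_0)
  \<comment> \<open>At \<open>t = 1\<close> the factors \<open>1 + t\<^sup>p\<close> become \<open>2\<close>.\<close>
  define v where "v n = 2 * ?a p n + 2 * ?b p n + 2 * ?c p n + ?d p n + ?e p n" for n
  have "int p dvd (\<Sum>n\<in>{0<..<p}. v n)"
  proof (rule sum_dvd_if_odd)
    show "odd p" using p prime_odd_nat by auto
    fix n assume n: "0 < n" "n < p"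
    note i = inv_mod_reflect[OF p(1)]
    have B: "[sum_below inv_mod p (p - n) = - 1 * sum_above inv_mod p n] (mod int p)" if "0 < n" "n < p" for n
      using that i by (intro sum_below_reflect) auto
    have A: "[sum_above inv_mod p (p - n) = - 1 * sum_below inv_mod p n] (mod int p)" if "0 < n" "n < p" for n
      using that i by (intro sum_above_reflect) auto
    have oB: "[over (sum_below inv_mod) p (p - n) = - (- 1) * over (sum_above inv_mod) p n] (mod int p)"
      if "0 < n" "n < p" for n
      using that B by (intro over_reflect p) auto
    have oA: "[over (sum_above inv_mod) p (p - n) = - (- 1) * over (sum_below inv_mod) p n] (mod int p)"
      if "0 < n" "n < p" for n
      using that A by (intro over_reflect p) auto
    have a: "[?a p (p - n) = - (- (- 1)) * ?b p n] (mod int p)"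
      by (rule over_reflect[OF p(1) n], rule sum_below_reflect[OF n(2)], rule oB)
    have b: "[?b p (p - n) = - (- (- 1)) * ?a p n] (mod int p)"
      by (rule over_reflect[OF p(1) n], rule sum_above_reflect[OF n], rule oA)
    have c: "[?c p (p - n) = - 1 * ?c p n] (mod int p)"
      using cong_mult[OF B[OF n] A[OF n]] n by (intro over_reflect p) (auto simp: mult.commute)
    have d: "[?d p (p - n) = - (- (- 1)) * ?e p n] (mod int p)"
      by (rule over_reflect[OF p(1) n], rule oB[OF n])
    have e: "[?e p (p - n) = - (- (- 1)) * ?d p n] (mod int p)"
      by (rule over_reflect[OF p(1) n], rule oA[OF n])
    have "[v (p - n) = 2 * (- (- (- 1)) * ?b p n) + 2 * (- (- (- 1)) * ?a p n) + 2 * (- 1 * ?c p n)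
        + - (- (- 1)) * ?e p n + - (- (- 1)) * ?d p n] (mod int p)"
      unfolding v_def by (intro cong_add cong_mult cong_refl a b c d e)
    then show "[v (p - n) = - v n] (mod int p)" by (simp add: v_def algebra_simps)
  qed
  then show "int p dvd poly (?g p) 1"
    by (simp add: poly_gen_poly_1 t_var_def v_def sum.distrib sum_distrib_left)
qed

theorem corollary4p3:
  shows
  "(1 + t_bold_p) * polylog [1,1,1] t_var
   + t_bold_p * (1 + t_bold_p) * polylog_tilde [1,1,1] t_var
   + 2 * t_bold_p * polylog_star [1,1,1] [1, t_var, 1]
   + t_bold_p * polylog [1,2] t_var
   + t_bold_p * polylog_tilde [2,1] t_var
   =
   (2 - t_bold_p) * polylog [1,1,1] (1 - t_var)
   + (2 - t_bold_p) * (1 - t_bold_p) * polylog_tilde [1,1,1] (1 - t_var)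
   + 2 * (1 - t_bold_p) * polylog_star [1,1,1] [1, 1 - t_var, 1]
   + (1 - t_bold_p) * polylog [1,2] (1 - t_var)
   + (1 - t_bold_p) * polylog_tilde [2,1] (1 - t_var)"
  (is "?lhs = ?rhs")
proof -
  have pl: "reflect (polylog ks t_var) = polylog ks (1 - t_var)"
    and pt: "reflect (polylog_tilde ks t_var) = polylog_tilde ks (1 - t_var)" if "ks \<noteq> []" for ks
    using that by (simp_all add: polylog_def polylog_tilde_def reflect_polylog_star pcompose_1 Suc_leI)
  have ps: "reflect (polylog_star [1,1,1] [1, t_var, 1]) = polylog_star [1,1,1] [1, 1 - t_var, 1]"
    by (simp add: reflect_polylog_star pcompose_1)
  have r2: "reflect 2 = 2" by (simp only: two_adelic reflect_add reflect_1)
  have T: "reflect (1 + t_bold_p) = 2 - t_bold_p"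
    by (simp only: reflect_add reflect_1 reflect_t_bold_p two_adelic add_diff_eq)
  have "?lhs = weight_three" by (simp only: weight_three_def)
  also have "\<dots> = reflect weight_three" by (rule reflect_weight_three[symmetric])
  also have "\<dots> = (2 - t_bold_p) * polylog [1,1,1] (1 - t_var)
   + (1 - t_bold_p) * (2 - t_bold_p) * polylog_tilde [1,1,1] (1 - t_var)
   + 2 * (1 - t_bold_p) * polylog_star [1,1,1] [1, 1 - t_var, 1]
   + (1 - t_bold_p) * polylog [1,2] (1 - t_var)
   + (1 - t_bold_p) * polylog_tilde [2,1] (1 - t_var)"
    unfolding weight_three_def by (simp add: reflect_add[of _ "_ * _"] reflect_mult T r2 reflect_t_bold_p pl pt ps del: One_nat_def)
  also have "\<dots> = ?rhs" by (simp only: mult.commute[of "1 - t_bold_p" "2 - t_bold_p"])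
  finally show ?thesis .
qed

end
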